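(* Let $F_k:\mathbb{R}^n\to\mathcal{I}$ ($k=1,\dots,m$) be interval-valued functions, $g_j:\mathbb{R}^n\to\mathbb{R}$ ($j=1,\dots,p$) functions, $F=(F_1,\dots,F_m)$ and $S:=\{u\in\mathbb{R}^n: g_j(u)\le 0,\ j=1,\dots,p\}$. Let $\varepsilon=(\varepsilon_1,\dots,\varepsilon_m)\in\mathbb{R}^m_+\setminus\{0\}$ and $\overline{u}\in S$. Assume that $$\sum_{k=1}^{m}\big(F^c_k(u)+F^w_k(u)\big)+\sum_{k=1}^{m}\varepsilon_k\|u-\overline{u}\|\geq \sum_{k=1}^{m}\big(F^c_k(\overline{u})+F^w_k(\overline{u})\big)\quad\text{for all } u\in S.$$ Then $QM(F,S,\varepsilon)\neq\emptyset$.
   Context: $\mathcal{I}$ is the set of all compact intervals $[\underline q,\overline q]$ with $\underline q\le\overline q$ real. For $Q=[\underline q,\overline q]\in\mathcal I$ put $q^c=\frac{\underline q+\overline q}{2}$ and $q^w=\frac{\overline q-\underline q}{2}$. Addition: $[\underline q,\overline q]+[\underline r,\overline r]=[\underline q+\underline r,\overline q+\overline r]$. Order: $Q\prec_{CW}R$ iff $q^c<r^c$ and $q^w<r^w$. $\mathbb{R}^m_+$ is the nonnegative orthant of $\mathbb{R}^m$; $\|\cdot\|$ is the norm on $\mathbb{R}^n$. For $F_k=[\underline F_k,\overline F_k]$, $F_k^c=\frac{\underline F_k+\overline F_k}{2}$ and $F_k^w=\frac{\overline F_k-\underline F_k}{2}$. $QM(F,S,\varepsilon)$ (weak $\varepsilon$-quasi-minimal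 solutions) is the set of $z_0\in S$ for which there is no $z\in S$ with $F_k(z)+[0,\varepsilon_k\|z-z_0\|]\prec_{CW}F_k(z_0)$ for all $k=1,\dots,m$. *)

theory Defs
  imports "HOL-Analysis.Analysis" "HOL-Library.Interval"
begin

definition icenter :: "real interval \<Rightarrow> real" where
  "icenter Q = (lower Q + upper Q) / 2"

(* Half of the library's Interval.width. *)
definition ihalfwidth :: "real interval \<Rightarrow> real" where
  "ihalfwidth Q = (upper Q - lower Q) / 2"

definition less_CW :: "real interval \<Rightarrow> real interval \<Rightarrow> bool" (infix \<open>\<prec>\<^sub>C\<^sub>W\<close> 50) where
  "Q \<prec>\<^sub>C\<^sub>W R \<longleftrightarrow> icenter Q < icenter R \<and> ihalfwidth Q < ihalfwidth R"

definition feasible_set :: "nat \<Rightarrow> (nat \<Rightarrow> real ^ 'n \<Rightarrow> real) \<Rightarrow> (real ^ 'n) set" where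
  "feasible_set p g = {u. \<forall>j\<in>{1..p}. g j u \<le> 0}"

(* Interval (0, t) is the interval [0, t] only for t \<ge> 0, so QM is meaningful
   only for vectors \<epsilon> with nonnegative components. *)
definition QM :: "('m::finite \<Rightarrow> real ^ 'n \<Rightarrow> real interval) \<Rightarrow> (real ^ 'n) set \<Rightarrow> real ^ 'm
    \<Rightarrow> (real ^ 'n) set" where
  "QM F S \<epsilon> = {z\<^sub>0 \<in> S. \<not> (\<exists>z\<in>S. \<forall>k.
      F k z + Interval (0, \<epsilon> $ k * norm (z - z\<^sub>0)) \<prec>\<^sub>C\<^sub>W F k z\<^sub>0)}"

end

theory Submission
  imports Defs
begin

text \<open>
  Since \<open>q\<^sup>c + q\<^sup>w\<close> is the upper endpoint of \<open>Q\<close>, the relation \<open>\<prec>\<^sub>C\<^sub>W\<close> forces a strict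
  inequality of upper endpoints. If some \<open>z\<close> excluded \<open>ubar\<close> from the quasi-minimal set, summing
  these inequalities over the objectives would contradict the hypothesis at \<open>u = z\<close>; hence \<open>ubar\<close>
  itself is quasi-minimal.
\<close>

text \<open>\<open>Interval\<close> is the abstraction map of a subtype of ordered pairs, so
  \<open>Interval_inverse\<close> applies only once \<open>a \<le> b\<close> is known.\<close>

lemma upper_Interval: "a \<le> b \<Longrightarrow> upper (Interval (a, b)) = b"
  by (simp add: upper.rep_eq Interval_inverse)

lemma icenter_plus_ihalfwidth: "icenter Q + ihalfwidth Q = upper Q"
  by (simp add: icenter_def ihalfwidth_def field_simps)

lemma less_CW_imp_upper_less:
  assumes "Q \<prec>\<^sub>C\<^sub>W R"
  shows "upper Q < upper R"
  using assms add_strict_mono[of "icenter Q" "icenter R" "ihalfwidth Q" "ihalfwidth R"]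
  by (simp add: less_CW_def icenter_plus_ihalfwidth)

theorem theorem3p3:
  fixes F :: "'m::finite \<Rightarrow> real ^ 'n \<Rightarrow> real interval"
    and g :: "nat \<Rightarrow> real ^ 'n \<Rightarrow> real"
    and p :: nat
    and S :: "(real ^ 'n) set"
    and \<epsilon> :: "real ^ 'm"
    and ubar :: "real ^ 'n"
  assumes S_eq: "S = feasible_set p g"
    and eps_nonneg: "\<forall>k. 0 \<le> \<epsilon> $ k"
    and eps_nonzero: "\<epsilon> \<noteq> 0"
    and ubar_in: "ubar \<in> S"
    and bound: "\<forall>u\<in>S.
      (\<Sum>k\<in>UNIV. icenter (F k u) + ihalfwidth (F k u)) + (\<Sum>k\<in>UNIV. \<epsilon> $ k * norm (u - ubar))
        \<ge> (\<Sum>k\<in>UNIV. icenter (F k ubar) + ihalfwidth (F k ubar))"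
  shows "QM F S \<epsilon> \<noteq> {}"
proof -
  have "\<not> (\<exists>z\<in>S. \<forall>k. F k z + Interval (0, \<epsilon> $ k * norm (z - ubar)) \<prec>\<^sub>C\<^sub>W F k ubar)"
  proof
    assume "\<exists>z\<in>S. \<forall>k. F k z + Interval (0, \<epsilon> $ k * norm (z - ubar)) \<prec>\<^sub>C\<^sub>W F k ubar"
    then obtain z where z: "z \<in> S"
      and less: "\<And>k. F k z + Interval (0, \<epsilon> $ k * norm (z - ubar)) \<prec>\<^sub>C\<^sub>W F k ubar"
      by blast
    have "upper (F k z) + \<epsilon> $ k * norm (z - ubar) < upper (F k ubar)" for k
      \<comment> \<open>Nonnegativity of \<open>\<epsilon> $ k\<close> makes the added interval
        proper, so its upper endpoint is the product.\<close>
      using less_CW_imp_upper_less[OF less[of k]] eps_nonneg by (simp add: upper_Interval)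
    then have "(\<Sum>k\<in>UNIV. upper (F k z) + \<epsilon> $ k * norm (z - ubar)) < (\<Sum>k\<in>UNIV. upper (F k ubar))"
      \<comment> \<open>Strictness survives summation because \<open>UNIV\<close> over
        \<open>'m\<close> is finite and nonempty.\<close>
      by (intro sum_strict_mono) auto
    with bound z show False
      by (fastforce simp: icenter_plus_ihalfwidth sum.distrib)
  qed
  with ubar_in have "ubar \<in> QM F S \<epsilon>"
    by (simp add: QM_def)
  then show ?thesis
    by blast
qed

end
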